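(* Let $M$ be a simple matroid of rank $3$ on $E$ and let $E=E_1\cup E_2$ be a partition of the points of the geometric representation of $M$ such that 1) $r(M|_{E_1})\ge 2$ and $r(M|_{E_2})=3$; 2) for each line $l$ of $M$, if $l\cap E_1\neq\emptyset$, then $|l\cap E_2|\le 1$. Then $E=E_1\cup E_2$ is a good $2$-partition of $M$.
   Context: A rank-$3$ matroid is represented geometrically by points in the plane, one for each element, together with (possibly curved) lines, any two of which meet in at most one point; the bases are the $3$-subsets of points that are not collinear. The lines of $M$ are the lines of this diagram (i.e. the rank-$2$ flats of $M$), regarded as sets of points. $r(\cdot)$ denotes rank, $M|_A$ the restriction to $A$, and $\mathcal{I}(\cdot)$ the family of independent sets. Good $2$-partition: for a matroid $M$ on $E$ of rank $r\ge 2$, a partition $E=E_1\cup E_2$ with $r_i=r(M|_{E_i})>1$ for $i=1,2$ is a good $2$-partition if there exist integers $0<a_1<r_1$ and $0<a_2<r_2$ such that (P1) $r=a_1+a_2$; and (P2) if $X\in\mathcal{I}(M|_{E_1})$ with $|X|\le a_1$ and $Y\in\mathcal{I}(M|_{E_2})$ with $|Y|\le a_2$, then $X\cup Y\in\mathcal{I}(M)$. *)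

theory Defs
  imports Main
begin

record 'a matroid =
  ground :: "'a set"
  indeps :: "'a set set"

definition is_matroid :: "'a matroid \<Rightarrow> bool" where
  "is_matroid M \<longleftrightarrow>
     finite (ground M) \<and>
     (\<forall>X\<in>indeps M. X \<subseteq> ground M) \<and>
     {} \<in> indeps M \<and>
     (\<forall>X\<in>indeps M. \<forall>Y. Y \<subseteq> X \<longrightarrow> Y \<in> indeps M) \<and>
     (\<forall>X\<in>indeps M. \<forall>Y\<in>indeps M. card X < card Y \<longrightarrow> (\<exists>y\<in>Y - X. insert y X \<in> indeps M))"

definition restriction :: "'a matroid \<Rightarrow> 'a set \<Rightarrow> 'a matroid" where
  "restriction M A = \<lparr>ground = ground M \<inter> A, indeps = {X \<in> indeps M. X \<subseteq> A}\<rparr>"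

text \<open>The rank of a matroid; the rank of a set \<open>A\<close> in \<open>M\<close> is \<open>rank (restriction M A)\<close>.
  \<open>Max\<close> is meaningful here because \<open>is_matroid M\<close> makes \<open>indeps M\<close> finite and nonempty.\<close>

definition rank :: "'a matroid \<Rightarrow> nat" where
  "rank M = Max (card ` indeps M)"

definition loop :: "'a matroid \<Rightarrow> 'a \<Rightarrow> bool" where
  "loop M e \<longleftrightarrow> e \<in> ground M \<and> {e} \<notin> indeps M"

definition parallel :: "'a matroid \<Rightarrow> 'a \<Rightarrow> 'a \<Rightarrow> bool" where
  "parallel M e f \<longleftrightarrow> e \<in> ground M \<and> f \<in> ground M \<and> e \<noteq> f \<and>
     \<not> loop M e \<and> \<not> loop M f \<and> {e, f} \<notin> indeps M"

definition simple_matroid :: "'a matroid \<Rightarrow> bool" where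
  "simple_matroid M \<longleftrightarrow> is_matroid M \<and> (\<nexists>e. loop M e) \<and> (\<nexists>e f. parallel M e f)"

definition flat :: "'a matroid \<Rightarrow> 'a set \<Rightarrow> bool" where
  "flat M F \<longleftrightarrow> F \<subseteq> ground M \<and>
     (\<forall>x\<in>ground M - F. rank (restriction M F) < rank (restriction M (insert x F)))"

text \<open>The lines of the geometric representation of a rank-3 matroid, as sets of points.
  Two-point lines are included, although diagrams usually leave them undrawn.\<close>

definition line :: "'a matroid \<Rightarrow> 'a set \<Rightarrow> bool" where
  "line M l \<longleftrightarrow> flat M l \<and> rank (restriction M l) = 2"

definition bipartition :: "'a set \<Rightarrow> 'a set \<Rightarrow> 'a set \<Rightarrow> bool" where
  "bipartition E E1 E2 \<longleftrightarrow> E1 \<union> E2 = E \<and> E1 \<inter> E2 = {} \<and> E1 \<noteq> {} \<and> E2 \<noteq> {}"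

definition good_2_partition :: "'a matroid \<Rightarrow> 'a set \<Rightarrow> 'a set \<Rightarrow> bool" where
  "good_2_partition M E1 E2 \<longleftrightarrow>
     is_matroid M \<and> rank M \<ge> 2 \<and> bipartition (ground M) E1 E2 \<and>
     rank (restriction M E1) > 1 \<and> rank (restriction M E2) > 1 \<and>
     (\<exists>a1 a2. 0 < a1 \<and> a1 < rank (restriction M E1) \<and>
              0 < a2 \<and> a2 < rank (restriction M E2) \<and>
              rank M = a1 + a2 \<and>
              (\<forall>X\<in>indeps (restriction M E1). \<forall>Y\<in>indeps (restriction M E2).
                 card X \<le> a1 \<and> card Y \<le> a2 \<longrightarrow> X \<union> Y \<in> indeps M))"

end

theory Submission
  imports Defs
begin

text \<open>
  The partition is good with \<open>a\<^sub>1 = 1\<close> and \<open>a\<^sub>2 = 2\<close>: a point \<open>x\<close> of \<open>E1\<close> never spoils the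
  independence of at most two points of \<open>E2\<close>. Simplicity settles the case of at most one point
  of \<open>E2\<close>. Two points of \<open>E2\<close> are independent and span a line (\<open>flat_span_indep\<close>, \<open>rank_span_indep\<close>); if they
  formed a dependent set together with \<open>x\<close>, then \<open>x\<close> would lie on that line, which would thus
  meet \<open>E1\<close> while containing two points of \<open>E2\<close>, against the second condition.
\<close>

lemma finite_indeps:
  assumes "is_matroid M"
  shows "finite (indeps M)"
proof (rule finite_subset)
  show "indeps M \<subseteq> Pow (ground M)" "finite (Pow (ground M))"
    using assms by (auto simp: is_matroid_def)
qed

lemma card_le_rank_restriction:
  assumes "is_matroid M" and "X \<in> indeps M" and "X \<subseteq> A"
  shows "card X \<le> rank (restriction M A)"
  using assms finite_indeps[OF assms(1)] by (auto simp: rank_def restriction_def intro: Max_ge)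

lemma rank_restriction_eqI:
  assumes "is_matroid M" and "B \<in> indeps M" and "B \<subseteq> A"
    and "\<And>X. X \<in> indeps M \<Longrightarrow> X \<subseteq> A \<Longrightarrow> card X \<le> card B"
  shows "rank (restriction M A) = card B"
  using assms finite_indeps[OF assms(1)]
  by (auto simp: rank_def restriction_def intro!: Max_eqI)

text \<open>For independent \<open>Y\<close> this is the closure of \<open>Y\<close>, described without the rank function, so
  that the exchange axiom applies to it directly.\<close>

definition span_indep :: "'a matroid \<Rightarrow> 'a set \<Rightarrow> 'a set" where
  "span_indep M Y = {e \<in> ground M. insert e Y \<in> indeps M \<longrightarrow> e \<in> Y}"

lemma subset_span_indep:
  assumes "is_matroid M" and "Y \<in> indeps M"
  shows "Y \<subseteq> span_indep M Y"
  using assms by (auto simp: is_matroid_def span_indep_def)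

text \<open>A larger independent set inside the span would, by exchange, supply an element of the span
  that extends \<open>Y\<close>.\<close>

lemma rank_span_indep:
  assumes M: "is_matroid M" and Y: "Y \<in> indeps M"
  shows "rank (restriction M (span_indep M Y)) = card Y"
proof (rule rank_restriction_eqI[OF M Y subset_span_indep[OF M Y]])
  fix X assume X: "X \<in> indeps M" "X \<subseteq> span_indep M Y"
  show "card X \<le> card Y"
  proof (rule ccontr)
    assume "\<not> card X \<le> card Y"
    then obtain e where "e \<in> X - Y" "insert e Y \<in> indeps M"
      using M X(1) Y unfolding is_matroid_def by (metis not_le)
    with X(2) show False by (auto simp: span_indep_def)
  qed
qed

lemma flat_span_indep:
  assumes M: "is_matroid M" and Y: "Y \<in> indeps M"
  shows "flat M (span_indep M Y)"
  unfolding flat_def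
proof (intro conjI ballI)
  show "span_indep M Y \<subseteq> ground M" by (auto simp: span_indep_def)
next
  fix e assume "e \<in> ground M - span_indep M Y"
  then have e: "insert e Y \<in> indeps M" "e \<notin> Y" by (auto simp: span_indep_def)
  have "finite Y" using M Y by (auto simp: is_matroid_def intro: finite_subset)
  then have "card Y < card (insert e Y)" using e(2) by simp
  also have "\<dots> \<le> rank (restriction M (insert e (span_indep M Y)))"
    using card_le_rank_restriction[OF M e(1)] subset_span_indep[OF M Y] by blast
  finally show "rank (restriction M (span_indep M Y))
      < rank (restriction M (insert e (span_indep M Y)))"
    by (simp add: rank_span_indep[OF M Y])
qed

lemma simple_matroid_pair_indep:
  assumes "simple_matroid M" and "e \<in> ground M" and "f \<in> ground M"
  shows "{e, f} \<in> indeps M"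
  using assms by (cases "e = f") (auto simp: simple_matroid_def loop_def parallel_def)

text \<open>Condition (P2) for a point \<open>x\<close> of one part, with \<open>E2\<close> in the role of the other part.\<close>

lemma insert_indep_if_lines_meet_once:
  assumes simple: "simple_matroid M"
    and lines: "\<And>l. line M l \<Longrightarrow> x \<in> l \<Longrightarrow> card (l \<inter> E2) \<le> 1"
    and x: "x \<in> ground M" and Y: "Y \<in> indeps M" "Y \<subseteq> E2" "card Y \<le> 2"
  shows "insert x Y \<in> indeps M"
proof -
  have M: "is_matroid M" using simple by (simp add: simple_matroid_def)
  have Y_ground: "Y \<subseteq> ground M" and fin: "finite Y"
    using M Y(1) by (auto simp: is_matroid_def intro: finite_subset)
  consider "card Y = 0" | "card Y = 1" | "card Y = 2" using Y(3) by linarith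
  then show ?thesis
  proof cases
    case 1
    then show ?thesis using simple_matroid_pair_indep[OF simple x x] fin by simp
  next
    case 2
    then obtain y where "Y = {y}" by (auto simp: card_1_singleton_iff)
    then show ?thesis using simple_matroid_pair_indep[OF simple x] Y_ground by simp
  next
    case 3
    let ?l = "span_indep M Y"
    show ?thesis
    proof (rule ccontr)
      assume "insert x Y \<notin> indeps M"
      then have "x \<in> ?l" using x by (simp add: span_indep_def)
      moreover have "line M ?l"
        using flat_span_indep[OF M Y(1)] rank_span_indep[OF M Y(1)] 3 by (simp add: line_def)
      ultimately have "card (?l \<inter> E2) \<le> 1" by (rule lines[rotated])
      moreover have "card Y \<le> card (?l \<inter> E2)"
      proof (rule card_mono)
        show "finite (?l \<inter> E2)" using M by (auto simp: is_matroid_def span_indep_def)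
        show "Y \<subseteq> ?l \<inter> E2" using subset_span_indep[OF M Y(1)] Y(2) by blast
      qed
      ultimately show False using 3 by simp
    qed
  qed
qed

theorem corollary3:
  fixes M :: "'a matroid" and E1 E2 :: "'a set"
  assumes "simple_matroid M"
    and "rank M = 3"
    and "bipartition (ground M) E1 E2"
    and "rank (restriction M E1) \<ge> 2"
    and "rank (restriction M E2) = 3"
    and "\<And>l. line M l \<Longrightarrow> l \<inter> E1 \<noteq> {} \<Longrightarrow> card (l \<inter> E2) \<le> 1"
  shows "good_2_partition M E1 E2"
proof -
  have M: "is_matroid M" using assms(1) by (simp add: simple_matroid_def)
  have P2: "X \<union> Y \<in> indeps M"
    if X: "X \<in> indeps (restriction M E1)" "card X \<le> 1"
      and Y: "Y \<in> indeps (restriction M E2)" "card Y \<le> 2" for X Y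
  proof -
    have Y': "Y \<in> indeps M" "Y \<subseteq> E2" using Y(1) by (auto simp: restriction_def)
    have X': "X \<in> indeps M" "X \<subseteq> E1" using X(1) by (auto simp: restriction_def)
    have "finite X" using M X'(1) by (auto simp: is_matroid_def intro: finite_subset)
    then consider "X = {}" | x where "X = {x}"
      using X(2) by (cases "card X") (auto simp: card_1_singleton_iff)
    then show ?thesis
    proof cases
      case 1
      then show ?thesis using Y'(1) by simp
    next
      case (2 x)
      then have "x \<in> E1" "x \<in> ground M" using X' M by (auto simp: is_matroid_def)
      then have "insert x Y \<in> indeps M"
        using insert_indep_if_lines_meet_once[OF assms(1) _ _ Y' Y(2)] assms(6) by blast
      then show ?thesis using 2 by simp
    qed
  qed
  show ?thesis
    unfolding good_2_partition_def
    using M assms(2-5) P2 by (intro conjI exI[of _ 1] exI[of _ 2]) auto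
qed

end
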